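(* Let $f(n)$ be a real-valued function of the positive integer $n\ge 3$ satisfying $1\le f(n)<\frac12 n(n-1)$. (i) If there is a constant $\ell\in\mathbb{R}^+$ (i.e. $\ell>0$) such that $\ell n\log n\le f(n)<\frac12 n(n-1)$, then $p(n)=\frac{f(n)+n\log\log n}{n^2}$ is a sharp threshold function for the property $mc(G(n,p))\ge f(n)$. (ii) If $f(n)=o(n\log n)$, then $p(n)=\frac{\log n}{n}$ is a sharp threshold function for the property $mc(G(n,p))\ge f(n)$.
   Context: All graphs are finite, simple and undirected; $\log$ denotes the natural logarithm. An edge-coloring of a connected graph $G$ (adjacent edges may receive the same color) is called a monochromatic connection coloring (MC-coloring) if any two vertices of $G$ are joined by a path all of whose edges have the same color. For a connected graph $G$, $mc(G)$ denotes the maximum number of colors used in an MC-coloring of $G$; if $G$ is not connected, set $mc(G)=0$. $G(n,p)$ denotes the Erdős–Rényi random graph on $n$ vertices, in which each of the $\binom n2$ pairs of vertices is an edge independently with probability $p\in[0,1]$. An event (depending on $n$) holds with high probability (w.h.p.) if its probability tends to $1$ as $n\to\infty$. For a graph property $P$ (which may depend on $n$), a function $p(n)$ is a sharp threshold function of $P$ if there exist two positive constants $c$ and $C$ such that: for every function $r(n)$ with values in $[0,1]$ and $r(n)\ge C\cdot p(n)$, $G(n,r(n))$ w.h.p. satisfies $P$; and for every function $r'(n)$ with values in $[0,1]$ and $r'(n)\le c\cdot p(n)$, $G(n,r'(n))$ w.h.p. does not satisfy $P$. *)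

theory Defs
  imports "HOL-Probability.Probability" "HOL-Library.Landau_Symbols"
begin

text \<open>A graph is a pair of a vertex set and a set of edges; an edge is a two-element set of
  vertices.\<close>

type_synonym 'a ugraph = "'a set \<times> 'a set set"

definition all_pairs :: "'a set \<Rightarrow> 'a set set" where
  "all_pairs V = {e. e \<subseteq> V \<and> card e = 2}"

definition simple_graph :: "'a ugraph \<Rightarrow> bool" where
  "simple_graph G \<longleftrightarrow> finite (fst G) \<and> snd G \<subseteq> all_pairs (fst G)"

definition path_edges :: "'a list \<Rightarrow> 'a set set" where
  "path_edges xs = {{xs ! i, xs ! Suc i} | i. Suc i < length xs}"

definition path_between :: "'a ugraph \<Rightarrow> 'a \<Rightarrow> 'a \<Rightarrow> 'a list \<Rightarrow> bool" where
  "path_between G u v xs \<longleftrightarrow>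
     xs \<noteq> [] \<and> hd xs = u \<and> last xs = v \<and> distinct xs \<and>
     set xs \<subseteq> fst G \<and> path_edges xs \<subseteq> snd G"

definition connected_graph :: "'a ugraph \<Rightarrow> bool" where
  "connected_graph G \<longleftrightarrow>
     fst G \<noteq> {} \<and> (\<forall>u\<in>fst G. \<forall>v\<in>fst G. \<exists>xs. path_between G u v xs)"

text \<open>Colors are natural numbers, which is no restriction for a finite graph. Only the values
  of \<open>c\<close> on the edges of \<open>G\<close> matter.\<close>

definition MC_coloring :: "'a ugraph \<Rightarrow> ('a set \<Rightarrow> nat) \<Rightarrow> bool" where
  "MC_coloring G c \<longleftrightarrow>
     (\<forall>u\<in>fst G. \<forall>v\<in>fst G. \<exists>xs k. path_between G u v xs \<and> (\<forall>e\<in>path_edges xs. c e = k))"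

definition mc :: "'a ugraph \<Rightarrow> nat" where
  "mc G = (if connected_graph G then Max {card (c ` snd G) | c. MC_coloring G c} else 0)"

text \<open>The maximum in the definition of \<open>mc\<close> ranges over a finite nonempty set.\<close>

lemma mc_set_finite_nonempty:
  assumes "simple_graph G" "connected_graph G"
  shows "finite {card (c ` snd G) | c. MC_coloring G c}"
    and "{card (c ` snd G) | c. MC_coloring G c} \<noteq> {}"
proof -
  have "finite (snd G)"
    using assms(1) finite_subset[of "snd G" "Pow (fst G)"]
    by (auto simp: simple_graph_def all_pairs_def)
  then have "{card (c ` snd G) | c. MC_coloring G c} \<subseteq> {..card (snd G)}"
    by (auto intro: card_image_le)
  then show "finite {card (c ` snd G) | c. MC_coloring G c}"
    using finite_subset by blast
  have "MC_coloring G (\<lambda>_. 0)"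
    using assms(2) by (auto simp: MC_coloring_def connected_graph_def)
  then show "{card (c ` snd G) | c. MC_coloring G c} \<noteq> {}"
    by blast
qed

text \<open>The random graph \<open>G(n,p)\<close> on the vertex set \<open>{1..n}\<close>: independent indicators, one for each
  pair of vertices, each true with probability \<open>p\<close>; the edges are the pairs whose indicator is
  true. The definition is meaningful for \<open>0 \<le> p \<le> 1\<close>.\<close>

definition random_graph :: "nat \<Rightarrow> real \<Rightarrow> nat ugraph pmf" where
  "random_graph n p =
     map_pmf (\<lambda>X. ({1..n}, {e \<in> all_pairs {1..n}. X e}))
       (Pi_pmf (all_pairs {1..n}) False (\<lambda>_. bernoulli_pmf p))"

definition whp :: "(nat \<Rightarrow> real) \<Rightarrow> (nat \<Rightarrow> nat ugraph \<Rightarrow> bool) \<Rightarrow> bool" where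
  "whp r P \<longleftrightarrow>
     (\<lambda>n. measure_pmf.prob (random_graph n (r n)) {G. P n G}) \<longlonglongrightarrow> 1"

text \<open>The inequalities \<open>r(n) \<ge> C p(n)\<close> and \<open>r'(n) \<le> c p(n)\<close> are required for all sufficiently
  large \<open>n\<close> only. Were the first one required for every \<open>n\<close>, a constant \<open>C\<close> with
  \<open>C p(n) > 1\<close> for a single small \<open>n\<close> would make the first condition vacuous.\<close>

definition sharp_threshold :: "(nat \<Rightarrow> real) \<Rightarrow> (nat \<Rightarrow> nat ugraph \<Rightarrow> bool) \<Rightarrow> bool" where
  "sharp_threshold p P \<longleftrightarrow>
     (\<exists>c>0. \<exists>C>0.
        (\<forall>r. (\<forall>n. 0 \<le> r n \<and> r n \<le> 1) \<and> (\<forall>\<^sub>F n in sequentially. r n \<ge> C * p n)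
             \<longrightarrow> whp r P) \<and>
        (\<forall>r'. (\<forall>n. 0 \<le> r' n \<and> r' n \<le> 1) \<and> (\<forall>\<^sub>F n in sequentially. r' n \<le> c * p n)
             \<longrightarrow> whp r' (\<lambda>n G. \<not> P n G)))"

end

theory Submission
  imports Defs "HOL-Real_Asymp.Real_Asymp"
begin

text \<open>
  The number \<open>mc G\<close> is tied to the number \<open>m\<close> of edges of \<open>G\<close>. Trivially \<open>mc G \<le> m\<close>. If \<open>G\<close> is
  connected on \<open>n\<close> vertices, giving one common color to a spanning tree and distinct fresh
  colors to all other edges is an MC-coloring, so \<open>mc G \<ge> m - n + 2\<close>; the slightly weaker
  bound \<open>mc G > m - n\<close> (\<open>mc_ge_of_small_cuts\<close>) suffices. If \<open>G\<close> is
  disconnected, \<open>mc G = 0\<close>. Hence \<open>mc G \<ge> f n\<close> is decided, up to constant factors in the edge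
  probability, by connectivity and by the number of edges.

  Above the threshold (\<open>whp_mc_ge\<close>) the edge probability \<open>r\<close> is at least \<open>6 ln n / n\<close>, so the
  random graph is connected by a union bound over cuts, and its expected number of edges is at
  least \<open>2 (f n + n)\<close>, so by Chebyshev's inequality it has more than \<open>f n + n\<close> edges.

  Below the threshold there are two different obstructions. If \<open>f n\<close> is at least of order
  \<open>n ln n\<close>, then \<open>n ln (ln n)\<close> is negligible against \<open>f n\<close>, and the expected number of edges is
  at most \<open>f n / 4\<close>: there are too few edges, again by Chebyshev (\<open>whp_mc_less_of_few_edges\<close>).
  If \<open>f n = o(n ln n)\<close>, the edge probability is at most \<open>ln n / (4 n)\<close>, and a second moment
  computation yields an isolated vertex (\<open>whp_not_connected\<close>), so that \<open>mc G = 0 < 1 \<le> f n\<close>.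

  Both Chebyshev estimates, for the edges and for the isolated vertices, are instances of one
  bound on the number of occurring events in a symmetric family (\<open>second_moment_count\<close>).
\<close>

section \<open>Edge cuts and monochromatic connection\<close>

definition cut :: "'a set \<Rightarrow> 'a set \<Rightarrow> 'a set set" where
  "cut V S = (\<lambda>(x, y). {x, y}) ` (S \<times> (V - S))"

lemma cut_subset_all_pairs: "S \<subseteq> V \<Longrightarrow> cut V S \<subseteq> all_pairs V"
  by (auto simp: cut_def all_pairs_def card_2_iff)

lemma card_cut:
  assumes "finite V" "S \<subseteq> V"
  shows "card (cut V S) = card S * (card V - card S)"
proof -
  have "inj_on (\<lambda>(x, y). {x, y}) (S \<times> (V - S))"
    by (auto simp: inj_on_def doubleton_eq_iff)
  then show ?thesis
    using assms by (simp add: cut_def card_image card_cartesian_product card_Diff_subset finite_subset)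
qed

lemma finite_all_pairs: "finite V \<Longrightarrow> finite (all_pairs V)"
  by (rule finite_subset[of _ "Pow V"]) (auto simp: all_pairs_def)

lemma path_edges_singleton [simp]: "path_edges [x] = {}"
  by (simp add: path_edges_def)

lemma path_edges_append_single:
  assumes "xs \<noteq> []"
  shows "path_edges (xs @ [y]) = insert {last xs, y} (path_edges xs)"
proof -
  have "{i. Suc i < length (xs @ [y])} = insert (length xs - 1) {i. Suc i < length xs}"
    using assms by (cases xs) auto
  moreover have "path_edges zs = (\<lambda>i. {zs ! i, zs ! Suc i}) ` {i. Suc i < length zs}" for zs :: "'a list"
    by (auto simp: path_edges_def)
  ultimately show ?thesis
    using assms by (auto simp: nth_append last_conv_nth)
qed

lemma path_edges_Cons:
  assumes "xs \<noteq> []"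
  shows "path_edges (y # xs) = insert {y, hd xs} (path_edges xs)"
proof -
  have "{i. Suc i < length (y # xs)} = insert 0 (Suc ` {i. Suc i < length xs})"
    using assms by (auto simp: image_iff) (metis less_Suc_eq_0_disj Suc_less_eq not0_implies_Suc)
  moreover have "path_edges zs = (\<lambda>i. {zs ! i, zs ! Suc i}) ` {i. Suc i < length zs}" for zs :: "'a list"
    by (auto simp: path_edges_def)
  ultimately show ?thesis
    using assms by (simp add: hd_conv_nth image_image)
qed

lemma path_between_mono:
  assumes "path_between (S, T) u v xs" "S \<subseteq> V" "T \<subseteq> E"
  shows "path_between (V, E) u v xs"
  using assms by (auto simp: path_between_def)

text \<open>A tree is grown one vertex at a time: as long as the set \<open>S\<close> of reached vertices is not all
  of \<open>V\<close>, some edge leaves \<open>S\<close>. The paths of the induction hypothesis stay inside \<open>S\<close>, so that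
  extending them by the new vertex keeps them free of repetitions.\<close>

lemma spanning_tree_of_crossing_edges:
  assumes "finite V" "V \<noteq> {}"
    and crossing: "\<And>S. S \<subseteq> V \<Longrightarrow> S \<noteq> {} \<Longrightarrow> S \<noteq> V \<Longrightarrow> E \<inter> cut V S \<noteq> {}"
  shows "\<exists>T\<subseteq>E. finite T \<and> card T < card V \<and> (\<forall>u\<in>V. \<forall>v\<in>V. \<exists>xs. path_between (V, T) u v xs)"
proof -
  have "\<exists>S T. S \<subseteq> V \<and> T \<subseteq> E \<and> finite T \<and> card S = Suc k \<and> card T < Suc k \<and>
          (\<forall>u\<in>S. \<forall>v\<in>S. \<exists>xs. path_between (S, T) u v xs)" if "k < card V" for k
    using that
  proof (induction k)
    case 0
    from \<open>V \<noteq> {}\<close> obtain v where "v \<in> V" by blast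
    moreover have "path_between ({v}, {}) v v [v]"
      by (simp add: path_between_def)
    ultimately show ?case
      by (intro exI[of _ "{v}"] exI[of _ "{}"]) auto
  next
    case (Suc k)
    then obtain S T where ST: "S \<subseteq> V" "T \<subseteq> E" "finite T" "card S = Suc k" "card T < Suc k"
      and paths: "\<And>u v. u \<in> S \<Longrightarrow> v \<in> S \<Longrightarrow> \<exists>xs. path_between (S, T) u v xs"
      by auto
    have "S \<noteq> {}" "S \<noteq> V"
      using ST Suc.prems by auto
    then obtain x y where xy: "x \<in> S" "y \<in> V" "y \<notin> S" "{x, y} \<in> E"
      using crossing[OF \<open>S \<subseteq> V\<close>] by (auto simp: cut_def)
    let ?S = "insert y S" and ?T = "insert {x, y} T"
    have "\<exists>xs. path_between (?S, ?T) u v xs" if uv: "u \<in> ?S" "v \<in> ?S" for u v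
    proof -
      consider "u = y" "v = y" | "u = y" "v \<in> S" | "u \<in> S" "v = y" | "u \<in> S" "v \<in> S"
        using uv by auto
      then show ?thesis
      proof cases
        case 1
        then have "path_between (?S, ?T) u v [y]"
          by (simp add: path_between_def)
        then show ?thesis by blast
      next
        case 2
        then obtain xs where "path_between (S, T) x v xs"
          using paths xy by blast
        then have "path_between (?S, ?T) u v (y # xs)"
          using xy 2 by (auto simp: path_between_def path_edges_Cons insert_commute)
        then show ?thesis by blast
      next
        case 3
        then obtain xs where "path_between (S, T) u x xs"
          using paths xy by blast
        then have "path_between (?S, ?T) u v (xs @ [y])"
          using xy 3 by (auto simp: path_between_def path_edges_append_single)
        then show ?thesis by blast
      next
        case 4
        then obtain xs where "path_between (S, T) u v xs"
          using paths by blast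
        then have "path_between (?S, ?T) u v xs"
          by (rule path_between_mono) auto
        then show ?thesis by blast
      qed
    qed
    moreover have "card ?S = Suc (Suc k)"
      using ST xy assms(1) by (simp add: finite_subset card_insert_if)
    moreover have "card ?T < Suc (Suc k)"
      using ST by (simp add: card_insert_if)
    ultimately show ?case
      using ST xy by (intro exI[of _ ?S] exI[of _ ?T]) auto
  qed
  from this[of "card V - 1"] obtain S T where
    *: "S \<subseteq> V" "T \<subseteq> E" "finite T" "card S = card V" "card T < card V"
       "\<forall>u\<in>S. \<forall>v\<in>S. \<exists>xs. path_between (S, T) u v xs"
    using assms by (auto simp: card_gt_0_iff)
  then have "S = V"
    using assms(1) card_subset_eq by blast
  then show ?thesis
    using * by blast
qed

text \<open>Color a spanning tree with \<open>0\<close> and the other edges with pairwise distinct positive colors;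
  any two vertices are joined inside the tree.\<close>

lemma mc_ge_of_crossing_edges:
  assumes G: "simple_graph (V, E)" "V \<noteq> {}"
    and crossing: "\<And>S. S \<subseteq> V \<Longrightarrow> S \<noteq> {} \<Longrightarrow> S \<noteq> V \<Longrightarrow> E \<inter> cut V S \<noteq> {}"
  shows "card E < mc (V, E) + card V"
proof -
  have fin: "finite V" "finite E"
    using G finite_subset[OF _ finite_all_pairs] by (auto simp: simple_graph_def)
  obtain T where T: "T \<subseteq> E" "finite T" "card T < card V"
    and paths: "\<And>u v. u \<in> V \<Longrightarrow> v \<in> V \<Longrightarrow> \<exists>xs. path_between (V, T) u v xs"
    using spanning_tree_of_crossing_edges[of V E] fin(1) G(2) crossing by metis
  have conn: "connected_graph (V, E)"
    unfolding connected_graph_def fst_conv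
    using paths path_between_mono[OF _ order_refl T(1)] G(2) by blast
  obtain h :: "'a set \<Rightarrow> nat" where h: "inj_on h (E - T)"
    using fin(2) finite_imp_inj_to_nat_seg[of "E - T"] by auto
  define c where "c e = (if e \<in> T then 0 else Suc (h e))" for e
  have "MC_coloring (V, E) c"
    unfolding MC_coloring_def
  proof (intro ballI)
    fix u v assume "u \<in> fst (V, E)" "v \<in> fst (V, E)"
    then obtain xs where xs: "path_between (V, T) u v xs"
      using paths by auto
    then have "\<forall>e\<in>path_edges xs. c e = 0"
      by (auto simp: path_between_def c_def)
    moreover have "path_between (V, E) u v xs"
      using xs T(1) by (auto intro: path_between_mono)
    ultimately show "\<exists>xs k. path_between (V, E) u v xs \<and> (\<forall>e\<in>path_edges xs. c e = k)"
      by blast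
  qed
  then have "card (c ` E) \<le> mc (V, E)"
    unfolding mc_def using conn mc_set_finite_nonempty(1)[OF G(1) conn]
    by (auto intro!: Max_ge)
  moreover have "card (c ` (E - T)) = card (E - T)"
    using h by (intro card_image) (auto simp: inj_on_def c_def)
  moreover have "card (c ` (E - T)) \<le> card (c ` E)"
    using fin by (intro card_mono) auto
  ultimately show ?thesis
    using T fin by (auto simp: card_Diff_subset)
qed

text \<open>Both sides \<open>S\<close> and \<open>V - S\<close> define the same cut. Restricting to sides of at most half the vertices
  is what makes the union bound over cuts converge: then each vertex of \<open>S\<close> has at least \<open>n/2\<close>
  potential neighbors outside \<open>S\<close>.\<close>

lemma mc_ge_of_small_cuts:
  assumes G: "simple_graph (V, E)" "V \<noteq> {}"
    and crossing: "\<And>S. S \<subseteq> V \<Longrightarrow> S \<noteq> {} \<Longrightarrow> 2 * card S \<le> card V \<Longrightarrow> E \<inter> cut V S \<noteq> {}"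
  shows "card E < mc (V, E) + card V"
proof (rule mc_ge_of_crossing_edges[OF G])
  fix S assume S: "S \<subseteq> V" "S \<noteq> {}" "S \<noteq> V"
  have fin: "finite V"
    using G by (simp add: simple_graph_def)
  have sym: "cut V (V - S) = cut V S"
    using S(1) by (auto simp: cut_def image_iff insert_commute)
  have "card (V - S) = card V - card S"
    using S fin by (simp add: card_Diff_subset finite_subset)
  then consider "2 * card S \<le> card V" | "2 * card (V - S) \<le> card V"
    by linarith
  then show "E \<inter> cut V S \<noteq> {}"
    using crossing[of S] crossing[of "V - S"] S sym by cases auto
qed

lemma mc_le_card_edges:
  assumes "simple_graph G"
  shows "mc G \<le> card (snd G)"
proof (cases "connected_graph G")
  case True
  have "finite (snd G)"
    using assms finite_subset[OF _ finite_all_pairs] by (auto simp: simple_graph_def)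
  then have "Max {card (c ` snd G) | c. MC_coloring G c} \<le> card (snd G)"
    using mc_set_finite_nonempty[OF assms True] by (subst Max_le_iff) (auto intro: card_image_le)
  then show ?thesis
    using True by (simp add: mc_def)
qed (simp add: mc_def)

lemma isolated_vertex_imp_not_connected:
  assumes "v \<in> V" "V \<noteq> {v}" "E \<subseteq> all_pairs V" "E \<inter> cut V {v} = {}"
  shows "\<not> connected_graph (V, E)"
proof
  assume conn: "connected_graph (V, E)"
  obtain u where u: "u \<in> V" "u \<noteq> v"
    using assms by auto
  obtain xs where xs: "path_between (V, E) v u xs"
    using conn u assms(1) by (auto simp: connected_graph_def)
  then obtain y ys where "xs = v # y # ys"
    using u by (cases xs; cases "tl xs") (auto simp: path_between_def)
  then have "{v, y} \<in> E" "y \<in> V" "y \<noteq> v"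
    using xs by (auto simp: path_between_def path_edges_Cons)
  then show False
    using assms(4) by (auto simp: cut_def)
qed

section \<open>Elementary probabilities in the random graph\<close>

lemma prob_Pi_pmf_bernoulli_all:
  assumes "finite A" "F \<subseteq> A" "0 \<le> p" "p \<le> 1"
  shows "measure_pmf.prob (Pi_pmf A False (\<lambda>_. bernoulli_pmf p)) {X. \<forall>e\<in>F. X e = b}
           = (if b then p else 1 - p) ^ card F"
proof -
  have "measure_pmf.prob (Pi_pmf A False (\<lambda>_. bernoulli_pmf p)) (Pi A (\<lambda>e. if e \<in> F then {b} else UNIV))
        = (\<Prod>e\<in>A. measure_pmf.prob (bernoulli_pmf p) (if e \<in> F then {b} else UNIV))"
    using assms(1) by (rule measure_Pi_pmf_Pi)
  also have "\<dots> = (\<Prod>e\<in>A. if e \<in> F then (if b then p else 1 - p) else 1)"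
    using assms by (intro prod.cong) (auto simp: measure_pmf_single)
  also have "\<dots> = (if b then p else 1 - p) ^ card F"
    using assms by (simp add: prod.If_cases Int_absorb1)
  also have "Pi A (\<lambda>e. if e \<in> F then {b} else UNIV) = {X. \<forall>e\<in>F. X e = b}"
    using assms(2) by (auto simp: Pi_def split: if_splits)
  finally show ?thesis .
qed

lemma prob_random_graph_contains:
  assumes "F \<subseteq> all_pairs {1..n}" "0 \<le> p" "p \<le> 1"
  shows "measure_pmf.prob (random_graph n p) {G. F \<subseteq> snd G} = p ^ card F"
proof -
  have "(\<lambda>X. ({1..n}, {e \<in> all_pairs {1..n}. X e})) -` {G. F \<subseteq> snd G} = {X. \<forall>e\<in>F. X e = True}"
    using assms(1) by auto
  then show ?thesis
    using prob_Pi_pmf_bernoulli_all[OF finite_all_pairs[of "{1..n}"] assms, of True]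
    by (simp add: random_graph_def)
qed

lemma prob_random_graph_avoids:
  assumes "F \<subseteq> all_pairs {1..n}" "0 \<le> p" "p \<le> 1"
  shows "measure_pmf.prob (random_graph n p) {G. snd G \<inter> F = {}} = (1 - p) ^ card F"
proof -
  have "(\<lambda>X. ({1..n}, {e \<in> all_pairs {1..n}. X e})) -` {G. snd G \<inter> F = {}} = {X. \<forall>e\<in>F. X e = False}"
    using assms(1) by auto
  then show ?thesis
    using prob_Pi_pmf_bernoulli_all[OF finite_all_pairs[of "{1..n}"] assms, of False]
    by (simp add: random_graph_def)
qed

lemma set_pmf_random_graph:
  assumes "G \<in> set_pmf (random_graph n p)"
  obtains E where "G = ({1..n}, E)" "E \<subseteq> all_pairs {1..n}"
  using assms by (auto simp: random_graph_def)

lemma finite_set_pmf_random_graph: "finite (set_pmf (random_graph n p))"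
proof (rule finite_subset)
  show "set_pmf (random_graph n p) \<subseteq> {{1..n}} \<times> Pow (all_pairs {1..n})"
    by (auto elim!: set_pmf_random_graph)
qed (simp add: finite_all_pairs)

lemma card_all_pairs: "real (card (all_pairs {1..n})) = real n * (real n - 1) / 2"
proof -
  have "card (all_pairs {1..n}) = n choose 2"
    unfolding all_pairs_def using n_subsets[of "{1..n}" 2] by simp
  moreover have "real (n choose 2) = real n * (real n - 1) / 2"
    by (cases n) (auto simp: choose_two real_of_nat_div algebra_simps)
  ultimately show ?thesis by simp
qed

lemma pmf_prob_mono:
  assumes "\<And>x. x \<in> set_pmf M \<Longrightarrow> x \<in> A \<Longrightarrow> x \<in> B"
  shows "measure_pmf.prob M A \<le> measure_pmf.prob M B"
  using assms by (intro measure_pmf.finite_measure_mono_AE) (auto simp: AE_measure_pmf_iff)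

lemma whpI:
  assumes "\<forall>\<^sub>F n in sequentially. measure_pmf.prob (random_graph n (r n)) {G. \<not> P n G} \<le> e n"
    and "e \<longlonglongrightarrow> 0"
  shows "whp r P"
proof -
  have compl: "measure_pmf.prob (random_graph n (r n)) {G. P n G}
      = 1 - measure_pmf.prob (random_graph n (r n)) {G. \<not> P n G}" for n
    using measure_pmf.prob_compl[of "{G. \<not> P n G}" "random_graph n (r n)"]
    by (simp add: Compl_eq_Diff_UNIV[symmetric] Collect_neg_eq[symmetric])
  have "(\<lambda>n. measure_pmf.prob (random_graph n (r n)) {G. \<not> P n G}) \<longlonglongrightarrow> 0"
    using assms by (intro tendsto_sandwich[OF _ assms(1) tendsto_const]) auto
  then have "(\<lambda>n. 1 - measure_pmf.prob (random_graph n (r n)) {G. \<not> P n G}) \<longlonglongrightarrow> 1 - 0"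
    by (intro tendsto_intros)
  then show ?thesis
    by (simp add: whp_def compl)
qed

section \<open>Second moments\<close>

text \<open>Chebyshev's inequality for the number of events \<open>A i\<close> that occur. Its mean is \<open>card I * a\<close>.
  In the second moment the diagonal contributes \<open>card I * a\<close> and the remaining pairs at most
  \<open>(card I)\<^sup>2 * b\<close>. The term \<open>b - a\<^sup>2\<close> is the covariance of two of the events: it vanishes for
  the edges, and it is small for isolated vertices.\<close>

lemma second_moment_count:
  fixes M :: "'a pmf"
  assumes M: "finite (set_pmf M)" and I: "finite I"
    and a: "\<And>i. i \<in> I \<Longrightarrow> measure_pmf.prob M (A i) = a"
    and b: "\<And>i j. i \<in> I \<Longrightarrow> j \<in> I \<Longrightarrow> i \<noteq> j \<Longrightarrow> measure_pmf.prob M (A i \<inter> A j) = b"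
    and "0 \<le> b" "0 < t"
  shows "measure_pmf.prob M {x. t \<le> \<bar>real (card {i\<in>I. x \<in> A i}) - real (card I) * a\<bar>}
           \<le> (real (card I) * a + (real (card I))\<^sup>2 * (b - a\<^sup>2)) / t\<^sup>2"
proof -
  define X where "X x = (\<Sum>i\<in>I. indicator (A i) x :: real)" for x
  have int: "integrable (measure_pmf M) g" for g :: "'a \<Rightarrow> real"
    using M by (rule integrable_measure_pmf_finite)
  have X: "real (card {i\<in>I. x \<in> A i}) = X x" for x
    using I by (simp add: X_def indicator_def sum.If_cases Int_def)
  have EX: "measure_pmf.expectation M X = real (card I) * a"
    unfolding X_def using a by (subst Bochner_Integration.integral_sum[OF int]) simp
  have "measure_pmf.expectation M (\<lambda>x. (X x)\<^sup>2) =
      measure_pmf.expectation M (\<lambda>x. \<Sum>i\<in>I. \<Sum>j\<in>I. indicator (A i \<inter> A j) x)"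
    by (simp add: X_def power2_eq_square sum_product indicator_inter_arith)
  also have "\<dots> = (\<Sum>i\<in>I. \<Sum>j\<in>I. measure_pmf.prob M (A i \<inter> A j))"
    by (simp add: Bochner_Integration.integral_sum int)
  also have "\<dots> \<le> (\<Sum>i\<in>I. \<Sum>j\<in>I. (if j = i then a else 0) + b)"
    using a b \<open>0 \<le> b\<close> by (intro sum_mono) auto
  also have "\<dots> = real (card I) * a + (real (card I))\<^sup>2 * b"
    using I by (simp add: sum.distrib power2_eq_square distrib_left mult.assoc)
  finally have EX2: "measure_pmf.expectation M (\<lambda>x. (X x)\<^sup>2) \<le> real (card I) * a + (real (card I))\<^sup>2 * b" .
  have "measure_pmf.prob M {x \<in> space M. t \<le> \<bar>X x - measure_pmf.expectation M X\<bar>}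
          \<le> measure_pmf.variance M X / t\<^sup>2"
    using int \<open>0 < t\<close> by (intro measure_pmf.Chebyshev_inequality) auto
  also have "\<dots> \<le> (real (card I) * a + (real (card I))\<^sup>2 * (b - a\<^sup>2)) / t\<^sup>2"
    using EX2 by (intro divide_right_mono, subst measure_pmf.variance_eq[OF int int])
      (auto simp: EX power_mult_distrib algebra_simps)
  finally show ?thesis
    by (simp add: X EX)
qed

lemma prob_edge_count_deviation:
  fixes n :: nat and p t :: real
  assumes "0 \<le> p" "p \<le> 1" "0 < t"
  defines "\<mu> \<equiv> real n * (real n - 1) / 2 * p"
  shows "measure_pmf.prob (random_graph n p) {G. t \<le> \<bar>real (card (snd G)) - \<mu>\<bar>} \<le> \<mu> / t\<^sup>2"
proof -
  let ?A = "\<lambda>e. {G :: nat ugraph. {e} \<subseteq> snd G}"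
  have pair: "?A e \<inter> ?A e' = {G. {e, e'} \<subseteq> snd G}" for e e' by auto
  have "measure_pmf.prob (random_graph n p) {G. t \<le> \<bar>real (card (snd G)) - \<mu>\<bar>}
    \<le> measure_pmf.prob (random_graph n p)
        {G. t \<le> \<bar>real (card {e \<in> all_pairs {1..n}. G \<in> ?A e}) - real (card (all_pairs {1..n})) * p\<bar>}"
  proof (rule pmf_prob_mono)
    fix G assume "G \<in> set_pmf (random_graph n p)"
    then obtain E where "G = ({1..n}, E)" "E \<subseteq> all_pairs {1..n}"
      by (rule set_pmf_random_graph)
    then have "{e \<in> all_pairs {1..n}. G \<in> ?A e} = snd G"
      by auto
    then show "G \<in> {G. t \<le> \<bar>real (card (snd G)) - \<mu>\<bar>} \<Longrightarrow> G \<in> {G. t \<le> \<bar>real (card {e \<in> all_pairs {1..n}. G \<in> ?A e}) - real (card (all_pairs {1..n})) * p\<bar>}"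
      by (simp only: mem_Collect_eq card_all_pairs \<mu>_def)
  qed
  also have "\<dots> \<le> (real (card (all_pairs {1..n})) * p + (real (card (all_pairs {1..n})))\<^sup>2 * (p\<^sup>2 - p\<^sup>2)) / t\<^sup>2"
  proof (rule second_moment_count[OF finite_set_pmf_random_graph])
    fix e e' assume e: "e \<in> all_pairs {1..n}" "e' \<in> all_pairs {1..n}" "e \<noteq> e'"
    then show "measure_pmf.prob (random_graph n p) (?A e \<inter> ?A e') = p\<^sup>2"
      unfolding pair using assms by (subst prob_random_graph_contains) (auto simp: power2_eq_square)
  next
    fix e assume "e \<in> all_pairs {1..n}"
    then show "measure_pmf.prob (random_graph n p) (?A e) = p"
      using assms by (subst prob_random_graph_contains) auto
  qed (use assms finite_all_pairs in auto)
  finally show ?thesis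
    by (simp only: card_all_pairs \<mu>_def) simp
qed

text \<open>Each vertex is isolated with probability \<open>(1 - p) ^ (n - 1)\<close>. Two vertices together see only
  \<open>2 n - 3\<close> pairs, since their common pair is counted once; this makes both events occur with
  probability \<open>1 / (1 - p)\<close> times the product of their probabilities, whence the second summand.
  The first summand is the inverse of the expected number of isolated vertices.\<close>

lemma prob_no_isolated_vertex:
  assumes "0 \<le> p" "p < 1" "2 \<le> n"
  shows "measure_pmf.prob (random_graph n p) {G. \<forall>v\<in>{1..n}. snd G \<inter> cut {1..n} {v} \<noteq> {}}
           \<le> 1 / (real n * (1 - p) ^ (n - 1)) + p / (1 - p)"
proof -
  let ?A = "\<lambda>v. {G :: nat ugraph. snd G \<inter> cut {1..n} {v} = {}}"
  define a where "a = (1 - p) ^ (n - 1)"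
  define b where "b = (1 - p) ^ (2 * n - 3)"
  have star: "cut {1..n} {v} \<subseteq> all_pairs {1..n}" "card (cut {1..n} {v}) = n - 1"
    if "v \<in> {1..n}" for v
    using that by (auto simp: cut_subset_all_pairs card_cut)
  have a: "measure_pmf.prob (random_graph n p) (?A v) = a" if "v \<in> {1..n}" for v
    using star[OF that] assms by (subst prob_random_graph_avoids) (auto simp: a_def)
  have b: "measure_pmf.prob (random_graph n p) (?A u \<inter> ?A v) = b"
    if uv: "u \<in> {1..n}" "v \<in> {1..n}" "u \<noteq> v" for u v
  proof -
    let ?F = "cut {1..n} {u} \<union> cut {1..n} {v}"
    have "cut {1..n} {u} \<inter> cut {1..n} {v} = {{u, v}}"
      using uv by (auto simp: cut_def image_iff doubleton_eq_iff)
    moreover have "finite (cut {1..n} {w})" for w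
      by (simp add: cut_def)
    ultimately have "card ?F + 1 = 2 * (n - 1)"
      using star[OF uv(1)] star[OF uv(2)] card_Un_Int[of "cut {1..n} {u}" "cut {1..n} {v}"] by simp
    then have "card ?F = 2 * n - 3"
      by simp
    moreover have "?A u \<inter> ?A v = {G. snd G \<inter> ?F = {}}"
      by auto
    ultimately show ?thesis
      using star[OF uv(1)] star[OF uv(2)] assms
      by (simp add: prob_random_graph_avoids b_def)
  qed
  have pos: "0 < a" "0 < b" "0 < real n * a"
    using assms by (auto simp: a_def b_def)
  have "2 * (n - 1) = Suc (2 * n - 3)"
    using assms by simp
  then have sq: "a\<^sup>2 = (1 - p) * b"
    unfolding a_def b_def power_mult[symmetric] by (simp add: mult.commute)
  \<comment> \<open>Having no isolated vertex is a deviation from the mean by the full mean \<open>n * a\<close>.\<close>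
  have "measure_pmf.prob (random_graph n p) {G. \<forall>v\<in>{1..n}. snd G \<inter> cut {1..n} {v} \<noteq> {}}
    \<le> measure_pmf.prob (random_graph n p)
        {G. real n * a \<le> \<bar>real (card {v \<in> {1..n}. G \<in> ?A v}) - real (card {1..n}) * a\<bar>}"
  proof (rule pmf_prob_mono)
    fix G :: "nat ugraph" assume "G \<in> {G. \<forall>v\<in>{1..n}. snd G \<inter> cut {1..n} {v} \<noteq> {}}"
    then have "{v \<in> {1..n}. G \<in> ?A v} = {}" by blast
    then have "card {v \<in> {1..n}. G \<in> ?A v} = 0" by (simp only: card.empty)
    then show "G \<in> {G. real n * a \<le> \<bar>real (card {v \<in> {1..n}. G \<in> ?A v}) - real (card {1..n}) * a\<bar>}"
      by (simp only: mem_Collect_eq card_atLeastAtMost) simp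
  qed
  also have "\<dots> \<le> (real (card {1..n}) * a + (real (card {1..n}))\<^sup>2 * (b - a\<^sup>2)) / (real n * a)\<^sup>2"
    by (rule second_moment_count[OF finite_set_pmf_random_graph]) (use a b pos in auto)
  also have "\<dots> = 1 / (real n * a) + (b - a\<^sup>2) / a\<^sup>2"
    using pos assms by (simp add: add_divide_distrib power_mult_distrib) (simp add: power2_eq_square)
  also have "(b - a\<^sup>2) / a\<^sup>2 = p / (1 - p)"
    using pos assms unfolding sq by (simp add: field_simps)
  finally show ?thesis
    by (simp add: a_def)
qed

section \<open>Connectivity\<close>

lemma sum_power_card_Pow:
  fixes q :: real
  assumes "finite V"
  shows "(\<Sum>S\<in>Pow V. q ^ card S) = (1 + q) ^ card V"
  using prod_add[OF assms, of "\<lambda>_. q" "\<lambda>_. 1"] by (simp add: add.commute)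

text \<open>The union bound. For \<open>card S = k \<le> n/2\<close> the cut has \<open>k (n - k) \<ge> k n / 2\<close> pairs, hence is empty
  with probability at most \<open>q ^ k\<close> for \<open>q = exp (- p n / 2)\<close>. Summed over all nonempty vertex
  sets, large ones included, these bounds give exactly \<open>(1 + q) ^ n - 1\<close>, which tends to \<open>0\<close> as
  soon as \<open>n q\<close> does.\<close>

lemma prob_empty_small_cut:
  assumes "0 \<le> p" "p \<le> 1"
  shows "measure_pmf.prob (random_graph n p)
           {G. \<exists>S\<subseteq>{1..n}. S \<noteq> {} \<and> 2 * card S \<le> n \<and> snd G \<inter> cut {1..n} S = {}}
         \<le> (1 + exp (- p * real n / 2)) ^ n - 1"
proof -
  define q where "q = exp (- p * real n / 2)"
  define I where "I = {S. S \<subseteq> {1..n} \<and> S \<noteq> {} \<and> 2 * card S \<le> n}"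
  have I: "I \<subseteq> Pow {1..n} - {{}}" "finite I"
    by (auto simp: I_def)
  have "{G. \<exists>S\<subseteq>{1..n}. S \<noteq> {} \<and> 2 * card S \<le> n \<and> snd G \<inter> cut {1..n} S = {}}
      = (\<Union>S\<in>I. {G :: nat ugraph. snd G \<inter> cut {1..n} S = {}})"
    by (auto simp: I_def)
  then have "measure_pmf.prob (random_graph n p)
           {G. \<exists>S\<subseteq>{1..n}. S \<noteq> {} \<and> 2 * card S \<le> n \<and> snd G \<inter> cut {1..n} S = {}}
      \<le> (\<Sum>S\<in>I. measure_pmf.prob (random_graph n p) {G. snd G \<inter> cut {1..n} S = {}})"
    using measure_pmf.finite_measure_subadditive_finite[OF I(2)] by auto
  also have "\<dots> \<le> (\<Sum>S\<in>I. q ^ card S)"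
  proof (rule sum_mono)
    fix S assume "S \<in> I"
    then have S: "S \<subseteq> {1..n}" "2 * card S \<le> n"
      by (auto simp: I_def)
    have half: "real n / 2 \<le> real (n - card S)"
      using S(2) by linarith
    have "(1 - p) ^ (n - card S) \<le> exp (- p) ^ (n - card S)"
      using assms exp_ge_add_one_self[of "- p"] by (intro power_mono) auto
    also have "\<dots> = exp (- p * real (n - card S))"
      by (simp add: exp_of_nat_mult[symmetric] mult.commute)
    also have "\<dots> \<le> q"
      using mult_left_mono[OF half assms(1)] by (simp add: q_def)
    finally have "(1 - p) ^ (n - card S) \<le> q" .
    then have "((1 - p) ^ (n - card S)) ^ card S \<le> q ^ card S"
      using assms by (intro power_mono) auto
    then show "measure_pmf.prob (random_graph n p) {G. snd G \<inter> cut {1..n} S = {}} \<le> q ^ card S"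
      using assms S by (simp add: prob_random_graph_avoids cut_subset_all_pairs card_cut
          power_mult[symmetric] mult.commute)
  qed
  also have "\<dots> \<le> (\<Sum>S\<in>Pow {1..n} - {{}}. q ^ card S)"
    using I by (intro sum_mono2) (auto simp: q_def)
  also have "\<dots> = (1 + q) ^ n - 1"
    using sum_power_card_Pow[of "{1..n}" q] by (simp add: sum_diff1)
  finally show ?thesis
    by (simp add: q_def)
qed

section \<open>The two sides of the thresholds\<close>

text \<open>The second hypothesis says that half the expected number of edges is at least \<open>f n + n\<close>. The
  constant \<open>6\<close> makes the \<open>q\<close> of \<open>prob_empty_small_cut\<close> at most \<open>n\<close> to the power \<open>-3\<close>.\<close>

lemma whp_mc_ge:
  assumes r: "\<And>n. 0 \<le> r n \<and> r n \<le> 1"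
    and conn: "\<forall>\<^sub>F n in sequentially. 6 * ln (real n) / real n \<le> r n"
    and edges: "\<forall>\<^sub>F n in sequentially. f n + real n \<le> real n * (real n - 1) / 4 * r n"
  shows "whp r (\<lambda>n G. real (mc G) \<ge> f n)"
proof (rule whpI)
  let ?e = "\<lambda>n. 4 / (3 * (real n - 1) * ln (real n)) + ((1 + 1 / real n ^ 3) ^ n - 1)"
  show "?e \<longlonglongrightarrow> 0"
    by real_asymp
  show "\<forall>\<^sub>F n in sequentially.
      measure_pmf.prob (random_graph n (r n)) {G. \<not> real (mc G) \<ge> f n} \<le> ?e n"
    using conn edges eventually_ge_at_top[of 3]
  proof eventually_elim
    case (elim n)
    let ?p = "r n" and ?M = "random_graph n (r n)"
    define \<mu> where "\<mu> = real n * (real n - 1) / 2 * ?p"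
    have ln: "0 < ln (real n)"
      using elim by simp
    have "3 * (real n - 1) * ln (real n) = real n * (real n - 1) / 2 * (6 * ln (real n) / real n)"
      using elim by (simp add: field_simps)
    also have "\<dots> \<le> \<mu>"
      unfolding \<mu>_def using elim by (intro mult_left_mono) auto
    finally have \<mu>: "3 * (real n - 1) * ln (real n) \<le> \<mu>" .
    have low_pos: "0 < 3 * (real n - 1) * ln (real n)"
      using ln elim by auto
    let ?B = "{G :: nat ugraph. \<mu> / 2 \<le> \<bar>real (card (snd G)) - \<mu>\<bar>}"
    let ?D = "{G :: nat ugraph. \<exists>S\<subseteq>{1..n}. S \<noteq> {} \<and> 2 * card S \<le> n \<and> snd G \<inter> cut {1..n} S = {}}"
    have "measure_pmf.prob ?M {G. \<not> real (mc G) \<ge> f n} \<le> measure_pmf.prob ?M (?B \<union> ?D)"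
    proof (rule pmf_prob_mono, rule ccontr)
      fix G assume "G \<in> set_pmf ?M" and few: "G \<in> {G. \<not> real (mc G) \<ge> f n}" and notin: "G \<notin> ?B \<union> ?D"
      then obtain E where G: "G = ({1..n}, E)" "E \<subseteq> all_pairs {1..n}"
        by (auto elim: set_pmf_random_graph)
      have "card E < mc ({1..n}, E) + card {1..n}"
        using notin G elim by (intro mc_ge_of_small_cuts) (auto simp: simple_graph_def)
      then have "real (card E) < real (mc G) + real n"
        using G by simp
      moreover have "\<mu> / 2 < real (card E)"
        using notin G by (auto simp: abs_if split: if_splits)
      ultimately show False
        using few elim by (simp add: \<mu>_def)
    qed
    also have "\<dots> \<le> measure_pmf.prob ?M ?B + measure_pmf.prob ?M ?D"
      by (rule measure_Un_le) auto
    also have "\<dots> \<le> ?e n"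
    proof (rule add_mono)
      have "measure_pmf.prob ?M ?B \<le> \<mu> / (\<mu> / 2)\<^sup>2"
        unfolding \<mu>_def using r \<mu> low_pos by (intro prob_edge_count_deviation) (auto simp: \<mu>_def)
      also have "\<dots> = 4 / \<mu>"
        by (simp add: power2_eq_square)
      also have "\<dots> \<le> 4 / (3 * (real n - 1) * ln (real n))"
        using \<mu> low_pos by (intro divide_left_mono) auto
      finally show "measure_pmf.prob ?M ?B \<le> 4 / (3 * (real n - 1) * ln (real n))" .
      have "exp (- ?p * real n / 2) \<le> exp (- (3 * ln (real n)))"
        using elim by (simp add: field_simps)
      also have "\<dots> = 1 / real n ^ 3"
        using elim exp_of_nat_mult[of 3 "ln (real n)"] by (simp add: exp_minus field_simps)
      finally have "(1 + exp (- ?p * real n / 2)) ^ n \<le> (1 + 1 / real n ^ 3) ^ n"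
        by (intro power_mono add_left_mono) (auto simp: add_nonneg_nonneg)
      moreover have "measure_pmf.prob ?M ?D \<le> (1 + exp (- ?p * real n / 2)) ^ n - 1"
        using r by (intro prob_empty_small_cut) auto
      ultimately show "measure_pmf.prob ?M ?D \<le> (1 + 1 / real n ^ 3) ^ n - 1"
        by linarith
    qed
    finally show ?case .
  qed
qed

lemma whp_mc_less_of_few_edges:
  assumes r: "\<And>n. 0 \<le> r n \<and> r n \<le> 1"
    and few: "\<forall>\<^sub>F n in sequentially. real n * (real n - 1) / 2 * r n \<le> f n / 4"
    and f: "filterlim f at_top sequentially"
  shows "whp r (\<lambda>n G. \<not> real (mc G) \<ge> f n)"
proof (rule whpI)
  show "(\<lambda>n. 1 / f n) \<longlonglongrightarrow> 0"
    using f by (intro tendsto_divide_0[OF tendsto_const] filterlim_at_top_imp_at_infinity)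
  show "\<forall>\<^sub>F n in sequentially.
      measure_pmf.prob (random_graph n (r n)) {G. \<not> \<not> real (mc G) \<ge> f n} \<le> 1 / f n"
    using few filterlim_at_top_dense[THEN iffD1, OF f, rule_format, of 0]
  proof eventually_elim
    case (elim n)
    define \<mu> where "\<mu> = real n * (real n - 1) / 2 * r n"
    have "measure_pmf.prob (random_graph n (r n)) {G. \<not> \<not> real (mc G) \<ge> f n}
        \<le> measure_pmf.prob (random_graph n (r n)) {G. f n / 2 \<le> \<bar>real (card (snd G)) - \<mu>\<bar>}"
    proof (rule pmf_prob_mono)
      fix G assume G: "G \<in> set_pmf (random_graph n (r n))" "G \<in> {G. \<not> \<not> real (mc G) \<ge> f n}"
      then have "simple_graph G"
        by (auto simp: simple_graph_def elim!: set_pmf_random_graph)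
      then have "real (mc G) \<le> real (card (snd G))"
        by (simp add: mc_le_card_edges)
      then show "G \<in> {G. f n / 2 \<le> \<bar>real (card (snd G)) - \<mu>\<bar>}"
        using G elim unfolding mem_Collect_eq \<mu>_def[symmetric] by (simp add: abs_if)
    qed
    also have "\<dots> \<le> \<mu> / (f n / 2)\<^sup>2"
      unfolding \<mu>_def using r elim by (intro prob_edge_count_deviation) auto
    also have "\<dots> \<le> (f n / 4) / (f n / 2)\<^sup>2"
      using elim by (intro divide_right_mono) (auto simp: \<mu>_def)
    also have "\<dots> = 1 / f n"
      using elim by (simp add: power2_eq_square)
    finally show ?case .
  qed
qed

text \<open>With \<open>p \<le> ln n / (4 n)\<close> and \<open>1 - p \<ge> exp (- 2 p)\<close>, the expected number of isolated vertices is
  at least \<open>n exp (- 2 p n) \<ge> sqrt n\<close>, which tends to infinity.\<close>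

lemma whp_not_connected:
  assumes r: "\<And>n. 0 \<le> r n \<and> r n \<le> 1"
    and small: "\<forall>\<^sub>F n in sequentially. r n \<le> 1 / 4 * (ln (real n) / real n)"
  shows "whp r (\<lambda>n G. \<not> connected_graph G)"
proof (rule whpI)
  let ?e = "\<lambda>n. 1 / sqrt (real n) + ln (real n) / real n / 2"
  show "?e \<longlonglongrightarrow> 0"
    by real_asymp
  have "\<forall>\<^sub>F n in sequentially. 1 / 4 * (ln (real n) / real n) \<le> 1 / 2"
    by real_asymp
  then show "\<forall>\<^sub>F n in sequentially.
      measure_pmf.prob (random_graph n (r n)) {G. \<not> \<not> connected_graph G} \<le> ?e n"
    using small eventually_ge_at_top[of 2]
  proof eventually_elim
    case (elim n)
    define p where "p = r n"
    have p: "0 \<le> p" "p \<le> 1 / 2" "p * real n \<le> ln (real n) / 4"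
      using r[of n] order_trans[OF elim(2,1)] elim(2,3) by (simp_all add: p_def field_simps)
    have "- p - 2 * p\<^sup>2 \<le> ln (1 - p)"
      using p by (intro ln_one_minus_pos_lower_bound) auto
    moreover have "2 * p\<^sup>2 \<le> p"
      using mult_left_mono[OF p(2) p(1)] by (simp add: power2_eq_square)
    ultimately have "- 2 * p \<le> ln (1 - p)" by simp
    then have base: "exp (- 2 * p) \<le> 1 - p"
      using p by (subst (asm) ln_ge_iff) auto
    have "sqrt (real n) = exp (ln (real n) / 2)"
      using elim by (simp add: ln_sqrt[symmetric])
    also have "\<dots> \<le> exp (ln (real n) + real n * (- 2 * p))"
      using p by (simp add: algebra_simps)
    also have "\<dots> = real n * exp (- 2 * p) ^ n"
      unfolding exp_add exp_of_nat_mult using elim by simp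
    also have "\<dots> \<le> real n * (1 - p) ^ n"
      using base by (intro mult_left_mono power_mono) auto
    also have "\<dots> \<le> real n * (1 - p) ^ (n - 1)"
      using p by (intro mult_left_mono power_decreasing) auto
    finally have mean: "sqrt (real n) \<le> real n * (1 - p) ^ (n - 1)" .
    have "measure_pmf.prob (random_graph n (r n)) {G. \<not> \<not> connected_graph G}
      \<le> measure_pmf.prob (random_graph n p) {G. \<forall>v\<in>{1..n}. snd G \<inter> cut {1..n} {v} \<noteq> {}}"
      unfolding p_def
    proof (rule pmf_prob_mono)
      fix G assume G: "G \<in> set_pmf (random_graph n (r n))" "G \<in> {G. \<not> \<not> connected_graph G}"
      then obtain E where E: "G = ({1..n}, E)" "E \<subseteq> all_pairs {1..n}"
        by (auto elim: set_pmf_random_graph)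
      have "{1..n} \<noteq> {v}" for v
        using elim arg_cong[of "{1..n}" "{v}" card] by auto
      then show "G \<in> {G. \<forall>v\<in>{1..n}. snd G \<inter> cut {1..n} {v} \<noteq> {}}"
        using isolated_vertex_imp_not_connected[OF _ _ E(2)] G(2)
        unfolding E(1) mem_Collect_eq snd_conv by blast
    qed
    also have "\<dots> \<le> 1 / (real n * (1 - p) ^ (n - 1)) + p / (1 - p)"
      using p elim by (intro prob_no_isolated_vertex) auto
    also have "1 / (real n * (1 - p) ^ (n - 1)) \<le> 1 / sqrt (real n)"
      using mean elim p by (intro divide_left_mono) auto
    also have "p / (1 - p) \<le> p / (1 / 2)"
      using p by (intro divide_left_mono) auto
    also have "p / (1 / 2) \<le> ln (real n) / real n / 2"
      using p elim by (simp add: field_simps)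
    finally show ?case by simp
  qed
qed

theorem theorem1p4:
  fixes f :: "nat \<Rightarrow> real"
  assumes "\<forall>n\<ge>3. 1 \<le> f n \<and> f n < 1/2 * real n * (real n - 1)"
  shows "((\<exists>l>0. \<forall>n\<ge>3. l * real n * ln (real n) \<le> f n \<and> f n < 1/2 * real n * (real n - 1)) \<longrightarrow>
           sharp_threshold (\<lambda>n. (f n + real n * ln (ln (real n))) / (real n)\<^sup>2)
                           (\<lambda>n G. real (mc G) \<ge> f n))
       \<and> (f \<in> o(\<lambda>n. real n * ln (real n)) \<longrightarrow>
           sharp_threshold (\<lambda>n. ln (real n) / real n)
                           (\<lambda>n G. real (mc G) \<ge> f n))"
proof (intro conjI impI)
  assume "\<exists>l>0. \<forall>n\<ge>3. l * real n * ln (real n) \<le> f n \<and> f n < 1/2 * real n * (real n - 1)"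
  then obtain l where l: "0 < l" and lf: "\<And>n. n \<ge> 3 \<Longrightarrow> l * real n * ln (real n) \<le> f n"
    by auto
  have lower: "\<forall>\<^sub>F n in sequentially. l * real n * ln (real n) \<le> f n"
    using eventually_ge_at_top[of 3] by eventually_elim (rule lf)
  have big: "\<forall>\<^sub>F n in sequentially. real n \<le> l * real n * ln (real n)"
      "\<forall>\<^sub>F n in sequentially. real n * ln (ln (real n)) \<le> l * real n * ln (real n)"
      "\<forall>\<^sub>F n in sequentially. 0 \<le> ln (ln (real n))"
    using l by real_asymp+
  have "filterlim (\<lambda>n. l * real n * ln (real n)) at_top sequentially"
    using l by real_asymp
  then have f_top: "filterlim f at_top sequentially"
    using lower by (rule filterlim_at_top_mono)
  \<comment> \<open>\<open>C * l \<ge> 6\<close> gives connectivity, because \<open>f n \<ge> l n ln n\<close>; \<open>C \<ge> 16\<close> gives the edge count: half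
    the expected number of edges is at least \<open>n (n - 1) / 4 * C f n / n\<^sup>2 \<ge> C f n / 8 \<ge> 2 f n\<close>, and
    \<open>f n \<ge> n\<close> eventually.\<close>
  define C where "C = 16 + 6 / l"
  have C: "0 < C" "16 \<le> C" "6 \<le> C * l"
    using l by (auto simp: C_def field_simps)
  let ?p = "\<lambda>n. (f n + real n * ln (ln (real n))) / (real n)\<^sup>2"
  show "sharp_threshold ?p (\<lambda>n G. real (mc G) \<ge> f n)"
    unfolding sharp_threshold_def
  proof (rule exI[of _ "1/4"], intro conjI, simp, rule exI[of _ C], intro conjI allI impI)
    fix r assume r: "(\<forall>n. 0 \<le> r n \<and> r n \<le> 1) \<and> (\<forall>\<^sub>F n in sequentially. C * ?p n \<le> r n)"
    then have large: "\<forall>\<^sub>F n in sequentially. C * ?p n \<le> r n" by simp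
    have enough: "\<forall>\<^sub>F n in sequentially. C * f n \<le> r n * (real n)\<^sup>2"
      using large big(3) eventually_ge_at_top[of 1]
    proof eventually_elim
      case (elim n)
      have "C * f n \<le> C * (f n + real n * ln (ln (real n)))"
        using C elim by (intro mult_left_mono) auto
      also have "\<dots> \<le> r n * (real n)\<^sup>2"
        using elim by (simp add: field_simps)
      finally show ?case .
    qed
    show "whp r (\<lambda>n G. real (mc G) \<ge> f n)"
    proof (rule whp_mc_ge)
      show "\<forall>\<^sub>F n in sequentially. 6 * ln (real n) / real n \<le> r n"
        using enough lower eventually_ge_at_top[of 1]
      proof eventually_elim
        case (elim n)
        have "6 * (real n * ln (real n)) \<le> C * l * (real n * ln (real n))"
          using C elim by (intro mult_right_mono) auto
        also have "\<dots> \<le> C * f n"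
          using C elim by (simp add: mult.assoc)
        also have "\<dots> \<le> r n * (real n)\<^sup>2" by fact
        finally show ?case
          using elim by (simp add: field_simps power2_eq_square)
      qed
      show "\<forall>\<^sub>F n in sequentially. f n + real n \<le> real n * (real n - 1) / 4 * r n"
        using enough lower big(1) eventually_ge_at_top[of 2]
      proof eventually_elim
        case (elim n)
        have "0 \<le> f n"
          using elim of_nat_0_le_iff[of n, where 'a = real] by linarith
        then have "16 * f n \<le> C * f n"
          using C by (intro mult_right_mono)
        then have "16 * f n \<le> r n * (real n)\<^sup>2"
          using elim(1) by (rule order_trans)
        moreover have "real n \<le> f n"
          using elim(3,2) by (rule order_trans)
        ultimately have "16 * (f n + real n) \<le> 2 * (r n * (real n)\<^sup>2)"
          by simp
        also have "\<dots> = 2 * r n * real n * real n"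
          by (simp add: power2_eq_square)
        also have "\<dots> \<le> 2 * r n * real n * (2 * (real n - 1))"
          using r elim by (intro mult_left_mono) auto
        finally show ?case
          by (simp add: algebra_simps)
      qed
    qed (use r in auto)
  next
    fix r assume r: "(\<forall>n. 0 \<le> r n \<and> r n \<le> 1) \<and> (\<forall>\<^sub>F n in sequentially. r n \<le> 1/4 * ?p n)"
    then have small: "\<forall>\<^sub>F n in sequentially. r n \<le> 1/4 * ?p n" by simp
    show "whp r (\<lambda>n G. \<not> real (mc G) \<ge> f n)"
    proof (rule whp_mc_less_of_few_edges)
      \<comment> \<open>Eventually \<open>n ln (ln n) \<le> f n\<close>, so \<open>c = 1/4\<close> bounds the expected number of edges by
        \<open>n\<^sup>2 / 2 * (2 f n) / (4 n\<^sup>2)\<close>.\<close>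
      show "\<forall>\<^sub>F n in sequentially. real n * (real n - 1) / 2 * r n \<le> f n / 4"
        using small lower big(2) eventually_ge_at_top[of 1]
      proof eventually_elim
        case (elim n)
        have "real n * (real n - 1) / 2 * r n \<le> (real n)\<^sup>2 / 2 * r n"
          using r by (intro mult_right_mono) (auto simp: power2_eq_square algebra_simps)
        also have "\<dots> \<le> (f n + real n * ln (ln (real n))) / 8"
          using elim by (simp add: field_simps)
        also have "\<dots> \<le> f n / 4"
          using order_trans[OF elim(3,2)] by simp
        finally show ?case .
      qed
    qed (use r f_top in auto)
  qed (use C in auto)
next
  assume "f \<in> o(\<lambda>n. real n * ln (real n))"
  then have "\<forall>\<^sub>F n in sequentially. norm (f n) \<le> 1 * norm (real n * ln (real n))"
    by (rule landau_o.smallD) simp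
  then have upper: "\<forall>\<^sub>F n in sequentially. f n \<le> real n * ln (real n)"
    using eventually_ge_at_top[of 1] by eventually_elim auto
  have big: "\<forall>\<^sub>F n in sequentially. 1 \<le> ln (real n)"
    by real_asymp
  show "sharp_threshold (\<lambda>n. ln (real n) / real n) (\<lambda>n G. real (mc G) \<ge> f n)"
    unfolding sharp_threshold_def
  proof (rule exI[of _ "1/4"], intro conjI, simp, rule exI[of _ 16], intro conjI allI impI)
    \<comment> \<open>For \<open>C = 16\<close>, half the expected number of edges is at least \<open>4 (n - 1) ln n \<ge> 2 n ln n\<close>.\<close>
    fix r :: "nat \<Rightarrow> real" assume r: "(\<forall>n. 0 \<le> r n \<and> r n \<le> 1) \<and> (\<forall>\<^sub>F n in sequentially. 16 * (ln (real n) / real n) \<le> r n)"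
    then have large: "\<forall>\<^sub>F n in sequentially. 16 * (ln (real n) / real n) \<le> r n" by simp
    show "whp r (\<lambda>n G. real (mc G) \<ge> f n)"
    proof (rule whp_mc_ge)
      show "\<forall>\<^sub>F n in sequentially. 6 * ln (real n) / real n \<le> r n"
        using large big eventually_ge_at_top[of 1] by eventually_elim (simp add: field_simps)
      show "\<forall>\<^sub>F n in sequentially. f n + real n \<le> real n * (real n - 1) / 4 * r n"
        using large upper big eventually_ge_at_top[of 2]
      proof eventually_elim
        case (elim n)
        have "f n + real n * 1 \<le> real n * ln (real n) + real n * ln (real n)"
          using elim by (intro add_mono mult_left_mono) auto
        also have "\<dots> = real n / 2 * (4 * ln (real n))"
          by simp
        also have "\<dots> \<le> (real n - 1) * (4 * ln (real n))"
          using elim by (intro mult_right_mono) auto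
        also have "\<dots> = real n * (real n - 1) / 4 * (16 * (ln (real n) / real n))"
          using elim by (simp add: field_simps)
        also have "\<dots> \<le> real n * (real n - 1) / 4 * r n"
          using elim by (intro mult_left_mono) auto
        finally show ?case by simp
      qed
    qed (use r in auto)
  next
    fix r assume r: "(\<forall>n. 0 \<le> r n \<and> r n \<le> 1) \<and> (\<forall>\<^sub>F n in sequentially. r n \<le> 1/4 * (ln (real n) / real n))"
    then have disc: "whp r (\<lambda>n G. \<not> connected_graph G)"
      by (intro whp_not_connected) auto
    show "whp r (\<lambda>n G. \<not> real (mc G) \<ge> f n)"
    proof (rule whpI)
      show "(\<lambda>n. 1 - measure_pmf.prob (random_graph n (r n)) {G. \<not> connected_graph G}) \<longlonglongrightarrow> 0"
        using tendsto_diff[OF tendsto_const[of 1] disc[unfolded whp_def]] by simp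
      show "\<forall>\<^sub>F n in sequentially. measure_pmf.prob (random_graph n (r n)) {G. \<not> \<not> real (mc G) \<ge> f n}
              \<le> 1 - measure_pmf.prob (random_graph n (r n)) {G. \<not> connected_graph G}"
        using eventually_ge_at_top[of 3]
      proof eventually_elim
        case (elim n)
        have "1 \<le> f n"
          using assms elim by simp
        then have "measure_pmf.prob (random_graph n (r n)) {G. \<not> \<not> real (mc G) \<ge> f n}
            \<le> measure_pmf.prob (random_graph n (r n)) (UNIV - {G. \<not> connected_graph G})"
          by (intro pmf_prob_mono) (auto simp: mc_def split: if_splits)
        also have "\<dots> = 1 - measure_pmf.prob (random_graph n (r n)) {G. \<not> connected_graph G}"
          using measure_pmf.prob_compl[of "{G. \<not> connected_graph G}" "random_graph n (r n)"] by simp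
        finally show ?case .
      qed
    qed
  qed simp_all
qed

end
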